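(* Let $X=\mathbb{R}$ with its standard topology. Let $\mathcal{I}$ be an ideal on $\omega$, and let $\mathscr{F}=\{F_\eta:\eta\in\mathbb{R}\}$ be a rough family of uniformly bounded closed subsets of $\mathbb{R}$ such that the map $\mathbb{R}\to\mathcal{H}(\mathbb{R})$, $\eta\mapsto F_\eta$, is $\widehat{\tau}$-continuous. Then $c^b(\mathcal{I},\mathscr{F})$ coincides with the closure of $c^b(\mathcal{I}^\star,\mathscr{F})$ in $\ell_\infty$ (with respect to the supremum norm).
   Context: $\omega$ is the set of nonnegative integers. An ideal $\mathcal{I}$ on $\omega$ is a family $\mathcal{I}\subseteq\mathcal{P}(\omega)$ closed under subsets and finite unions, containing all finite subsets of $\omega$, and with $\omega\notin\mathcal{I}$. A rough family on a topological space $X$ is a collection $\mathscr{F}=\{F_\eta:\eta\in X\}$ of subsets of $X$ such that $\eta\in F_\eta$ for all $\eta\in X$. For $X=\mathbb{R}$, the sets $F_\eta$ are uniformly bounded if there exists $r\in[0,\infty)$ such that $F_\eta\subseteq[\eta-r,\eta+r]$ for all $\eta\in\mathbb{R}$. For a sequence $\bm{x}=(x_n:n\in\omega)$ in $X$: $\mathsf{Lim}_{\bm{x}}(\mathcal{I},\mathscr{F})$ is the set of all $\eta\in X$ such that $\{n\in\omega:x_n\notin U\}\in\mathcal{I}$ for all open sets $U\subseteq X$ with $F_\eta\subseteq U$. $\mathsf{Lim}_{\bm{x}}(\mathcal{I}^\star,\mathscr{F})$ is the set of all $\eta\in X$ for which there exists $S\in\mathcal{I}$ such that $\{n\in\omega\setminus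 S:x_n\notin U\}$ is finite for all open $U\subseteq X$ with $F_\eta\subseteq U$. $\ell_\infty$ is the Banach space of bounded real sequences indexed by $\omega$ with the supremum norm, and $$c^b(\mathcal{I},\mathscr{F}):=\{\bm{x}\in\ell_\infty:\mathsf{Lim}_{\bm{x}}(\mathcal{I},\mathscr{F})\neq\emptyset\},\qquad c^b(\mathcal{I}^\star,\mathscr{F}):=\{\bm{x}\in\ell_\infty:\mathsf{Lim}_{\bm{x}}(\mathcal{I}^\star,\mathscr{F})\neq\emptyset\}.$$ $\mathcal{H}(X)$ is the family of nonempty closed subsets of $X$, endowed with the upper Vietoris topology $\widehat{\tau}$, i.e. the topology generated by the base of sets $\{F\in\mathcal{H}(X):F\subseteq U\}$ with $U\subseteq X$ open. A map into $\mathcal{H}(X)$ is $\widehat{\tau}$-continuous if it is continuous with respect to $\widehat{\tau}$. *)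

theory Defs
  imports "HOL-Analysis.Analysis"
begin

definition omega_ideal :: "nat set set \<Rightarrow> bool" where
  "omega_ideal I \<longleftrightarrow>
     (\<forall>A\<in>I. \<forall>B. B \<subseteq> A \<longrightarrow> B \<in> I) \<and>
     (\<forall>A\<in>I. \<forall>B\<in>I. A \<union> B \<in> I) \<and>
     (\<forall>A. finite A \<longrightarrow> A \<in> I) \<and>
     UNIV \<notin> I"

text \<open>A family \<open>{F \<eta> : \<eta> \<in> X}\<close> is rendered as the indexed family \<open>F\<close>, where
  \<open>X\<close> is the whole type \<open>'a\<close>.\<close>

definition rough_family :: "('a \<Rightarrow> 'a set) \<Rightarrow> bool" where
  "rough_family F \<longleftrightarrow> (\<forall>\<eta>. \<eta> \<in> F \<eta>)"

definition uniformly_bounded_family :: "(real \<Rightarrow> real set) \<Rightarrow> bool" where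
  "uniformly_bounded_family F \<longleftrightarrow> (\<exists>r\<ge>0. \<forall>\<eta>. F \<eta> \<subseteq> {\<eta> - r..\<eta> + r})"

definition rough_Lim ::
  "(nat \<Rightarrow> 'a::topological_space) \<Rightarrow> nat set set \<Rightarrow> ('a \<Rightarrow> 'a set) \<Rightarrow> 'a set" where
  "rough_Lim x I F = {\<eta>. \<forall>U. open U \<longrightarrow> F \<eta> \<subseteq> U \<longrightarrow> {n. x n \<notin> U} \<in> I}"

definition rough_Lim_star ::
  "(nat \<Rightarrow> 'a::topological_space) \<Rightarrow> nat set set \<Rightarrow> ('a \<Rightarrow> 'a set) \<Rightarrow> 'a set" where
  "rough_Lim_star x I F =
     {\<eta>. \<exists>S\<in>I. \<forall>U. open U \<longrightarrow> F \<eta> \<subseteq> U \<longrightarrow> finite {n \<in> UNIV - S. x n \<notin> U}}"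

text \<open>Since \<open>nat\<close> carries the discrete topology, the type of bounded continuous functions
  \<open>nat \<Rightarrow>\<^sub>C real\<close> with its supremum norm is the Banach space of bounded real sequences.\<close>

type_synonym l_infty = "nat \<Rightarrow>\<^sub>C real"

lemma range_apply_l_infty:
  "range (apply_bcontfun :: l_infty \<Rightarrow> nat \<Rightarrow> real) = {x. bounded (range x)}"
  by (simp add: type_definition.Rep_range[OF type_definition_bcontfun] bcontfun_def)

lemma norm_l_infty: "norm (x :: l_infty) = (SUP n. \<bar>apply_bcontfun x n\<bar>)"
  by (simp add: norm_bcontfun_def dist_bcontfun_def zero_bcontfun.rep_eq dist_real_def)

definition cb_rough :: "nat set set \<Rightarrow> (real \<Rightarrow> real set) \<Rightarrow> l_infty set" where
  "cb_rough I F = {x. rough_Lim (apply_bcontfun x) I F \<noteq> {}}"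

definition cb_rough_star :: "nat set set \<Rightarrow> (real \<Rightarrow> real set) \<Rightarrow> l_infty set" where
  "cb_rough_star I F = {x. rough_Lim_star (apply_bcontfun x) I F \<noteq> {}}"

definition closed_hyperspace :: "'a::topological_space set set" where
  "closed_hyperspace = {F. F \<noteq> {} \<and> closed F}"

definition upper_vietoris :: "'a::topological_space set topology" where
  "upper_vietoris = topology_generated_by {{F \<in> closed_hyperspace. F \<subseteq> U} |U. open U}"

lemma topspace_upper_vietoris: "topspace upper_vietoris = closed_hyperspace"
  unfolding upper_vietoris_def topology_generated_by_topspace by blast

end

theory Submission
  imports Defs
begin

text \<open>If \<open>x\<close> converges roughly to \<open>\<eta>\<close> along \<open>I\<close>, then projecting onto \<open>F \<eta>\<close> those terms of \<open>x\<close> that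
  lie within \<open>e\<close> of \<open>F \<eta>\<close> moves \<open>x\<close> by at most \<open>e\<close> and yields a star-convergent sequence.
  Conversely, if \<open>y k \<longlonglongrightarrow> x\<close> uniformly and \<open>y k\<close> converges roughly to \<open>\<eta> k\<close>, uniform boundedness of
  the family confines the \<open>\<eta> k\<close> to a compact interval, and upper Vietoris continuity makes every
  cluster point of the \<open>\<eta> k\<close> a rough limit of \<open>x\<close>.\<close>

lemma omega_idealD:
  assumes "omega_ideal I"
  shows "A \<in> I \<Longrightarrow> B \<subseteq> A \<Longrightarrow> B \<in> I" "A \<in> I \<Longrightarrow> B \<in> I \<Longrightarrow> A \<union> B \<in> I"
    "finite A \<Longrightarrow> A \<in> I" "UNIV \<notin> I"
  using assms unfolding omega_ideal_def by simp_all

text \<open>The terms outside \<open>U\<close> have indices in \<open>S\<close> or in a finite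
  remainder, and both belong to the ideal.\<close>

lemma rough_Lim_star_subset_rough_Lim:
  assumes "omega_ideal I"
  shows "rough_Lim_star x I F \<subseteq> rough_Lim x I F"
proof
  fix \<eta> assume "\<eta> \<in> rough_Lim_star x I F"
  then obtain S where S: "S \<in> I"
    "\<And>U. open U \<Longrightarrow> F \<eta> \<subseteq> U \<Longrightarrow> finite {n \<in> UNIV - S. x n \<notin> U}"
    unfolding rough_Lim_star_def by blast
  have "{n. x n \<notin> U} \<in> I" if "open U" "F \<eta> \<subseteq> U" for U
  proof -
    have "S \<union> {n \<in> UNIV - S. x n \<notin> U} \<in> I"
      by (intro omega_idealD(2,3)[OF assms] S that)
    moreover have "{n. x n \<notin> U} \<subseteq> S \<union> {n \<in> UNIV - S. x n \<notin> U}" by auto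
    ultimately show ?thesis by (rule omega_idealD(1)[OF assms])
  qed
  then show "\<eta> \<in> rough_Lim x I F" unfolding rough_Lim_def by blast
qed

text \<open>Properness of the ideal is what rules out that every term avoids \<open>U\<close>. A
  single term near \<open>F \<eta>\<close> is enough to locate \<open>\<eta>\<close> below.\<close>

lemma rough_Lim_meets_nhd:
  assumes "omega_ideal I" "\<eta> \<in> rough_Lim x I F" "open U" "F \<eta> \<subseteq> U"
  obtains n where "x n \<in> U"
proof -
  have "{n. x n \<notin> U} \<in> I" using assms unfolding rough_Lim_def by blast
  then have "{n. x n \<notin> U} \<noteq> UNIV" using omega_idealD(4)[OF assms(1)] by auto
  then show ?thesis using that by blast
qed

lemma abs_rough_Lim_le:
  fixes x :: "nat \<Rightarrow> real"
  assumes "omega_ideal I" "\<eta> \<in> rough_Lim x I F" "F \<eta> \<subseteq> {\<eta> - r..\<eta> + r}"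
    and "\<And>n. \<bar>x n\<bar> \<le> M"
  shows "\<bar>\<eta>\<bar> \<le> M + r + 1"
proof -
  \<comment> \<open>Rough limits are tested on open sets only, so the closed interval is enlarged by
    1 to an open one.\<close>
  have "F \<eta> \<subseteq> {\<eta> - (r + 1)<..<\<eta> + (r + 1)}" using assms(3) by fastforce
  then obtain n where "x n \<in> {\<eta> - (r + 1)<..<\<eta> + (r + 1)}"
    using rough_Lim_meets_nhd[OF assms(1,2)] open_greaterThanLessThan by metis
  with assms(4)[of n] show ?thesis by auto
qed

text \<open>Upper Vietoris continuity is upper semicontinuity of the set-valued map:
  \<open>{\<eta>. F \<eta> \<subseteq> U}\<close> is the preimage of a basic open set, hence an open
  neighbourhood of \<open>a\<close>.\<close>

lemma eventually_subset_of_upper_vietoris: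
  assumes "continuous_map euclidean upper_vietoris F" "(f \<longlongrightarrow> a) net" "open U" "F a \<subseteq> U"
  shows "\<forall>\<^sub>F k in net. F (f k) \<subseteq> U"
proof -
  have top: "F \<eta> \<in> closed_hyperspace" for \<eta>
    using continuous_map_image_subset_topspace[OF assms(1)]
    by (auto simp: topspace_upper_vietoris)
  have "openin upper_vietoris {G \<in> closed_hyperspace. G \<subseteq> U}"
    unfolding upper_vietoris_def using assms(3)
    by (intro topology_generated_by_Basis) blast
  then have "openin euclidean {\<eta> \<in> topspace euclidean. F \<eta> \<in> {G \<in> closed_hyperspace. G \<subseteq> U}}"
    by (rule openin_continuous_map_preimage[OF assms(1)])
  then have "open {\<eta>. F \<eta> \<subseteq> U}" using top by simp
  from topological_tendstoD[OF assms(2) this] assms(4) show ?thesis by simp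
qed

lemma cb_rough_subset_closure:
  assumes "omega_ideal I" and "\<And>\<eta>. closed (F \<eta>)" and ne: "\<And>\<eta>. F \<eta> \<noteq> {}"
  shows "cb_rough I F \<subseteq> closure (cb_rough_star I F)"
proof
  fix x assume "x \<in> cb_rough I F"
  then obtain \<eta> where \<eta>: "\<eta> \<in> rough_Lim (apply_bcontfun x) I F"
    unfolding cb_rough_def by blast
  have "\<exists>z\<in>cb_rough_star I F. dist z x \<le> e" if "e > 0" for e
  proof -
    define U where "U = {t. infdist t (F \<eta>) < e}"
    define S where "S = {n. apply_bcontfun x n \<notin> U}"
    have "open U" unfolding U_def by (intro open_Collect_less continuous_intros)
    moreover have "F \<eta> \<subseteq> U" using that by (auto simp: U_def)
    ultimately have S: "S \<in> I" using \<eta> unfolding S_def rough_Lim_def by blast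
    \<comment> \<open>A nearest point exists because \<open>F \<eta>\<close> is closed and nonempty
      in the real line.\<close>
    have "\<forall>t. \<exists>q. q \<in> F \<eta> \<and> infdist t (F \<eta>) = dist t q"
      using infdist_attains_inf[OF assms(2) ne] by blast
    then obtain p where p: "\<And>t. p t \<in> F \<eta>" "\<And>t. infdist t (F \<eta>) = dist t (p t)"
      unfolding choice_iff by blast
    \<comment> \<open>Terms indexed by \<open>S\<close> may be far from \<open>F \<eta>\<close>;
      leaving them unchanged keeps \<open>y\<close> uniformly close to \<open>x\<close>, hence
      bounded.\<close>
    define y where "y n = (if n \<in> S then apply_bcontfun x n else p (apply_bcontfun x n))" for n
    have yx: "dist (y n) (apply_bcontfun x n) \<le> e" for n
      using p(2)[of "apply_bcontfun x n"] that
      by (auto simp: y_def S_def U_def dist_commute)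
    have "\<bar>y n\<bar> \<le> norm x + e" for n
      using yx[of n] norm_bounded[of x n] by (simp add: dist_real_def)
    then have "bounded (range y)" by (intro boundedI[of _ "norm x + e"]) auto
    then have "y \<in> range (apply_bcontfun :: l_infty \<Rightarrow> nat \<Rightarrow> real)"
      unfolding range_apply_l_infty by simp
    then obtain z :: l_infty where z: "apply_bcontfun z = y" by auto
    \<comment> \<open>Off \<open>S\<close> the terms of \<open>y\<close> lie in
      \<open>F \<eta>\<close> itself, so one \<open>S\<close> serves every \<open>V\<close> and no
      exceptions remain.\<close>
    have "finite {n \<in> UNIV - S. y n \<notin> V}" if "F \<eta> \<subseteq> V" for V
    proof -
      have "{n \<in> UNIV - S. y n \<notin> V} = {}" using that p(1) by (auto simp: y_def)
      then show ?thesis by (metis finite.emptyI)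
    qed
    then have "\<eta> \<in> rough_Lim_star y I F" using S unfolding rough_Lim_star_def by blast
    then have "z \<in> cb_rough_star I F" by (auto simp: cb_rough_star_def z)
    moreover have "dist z x \<le> e" using yx z by (intro dist_bound) auto
    ultimately show ?thesis by blast
  qed
  then show "x \<in> closure (cb_rough_star I F)"
    by (meson closure_approachable_le)
qed

lemma closed_cb_rough:
  assumes I: "omega_ideal I" and ne: "\<And>\<eta>. F \<eta> \<noteq> {}" and bdd: "uniformly_bounded_family F"
    and cl: "\<And>\<eta>. closed (F \<eta>)" and cont: "continuous_map euclidean upper_vietoris F"
  shows "closed (cb_rough I F)"
  unfolding closed_sequential_limits
proof (intro allI impI, elim conjE)
  fix y :: "nat \<Rightarrow> l_infty" and x
  assume mem: "\<forall>k. y k \<in> cb_rough I F" and lim: "y \<longlonglongrightarrow> x"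
  obtain r where r: "\<And>\<eta>. F \<eta> \<subseteq> {\<eta> - r..\<eta> + r}"
    using bdd unfolding uniformly_bounded_family_def by blast
  have "\<forall>k. \<exists>\<eta>. \<eta> \<in> rough_Lim (apply_bcontfun (y k)) I F"
    using mem unfolding cb_rough_def by blast
  then obtain a where a: "\<And>k. a k \<in> rough_Lim (apply_bcontfun (y k)) I F"
    unfolding choice_iff by blast
  \<comment> \<open>A norm bound common to all \<open>y k\<close> makes the bound on
    \<open>a k\<close> independent of \<open>k\<close>, so that Bolzano-Weierstrass applies.\<close>
  obtain M where "\<And>k. norm (y k) \<le> M"
    using convergent_imp_Bseq[OF convergentI[OF lim]] by (metis BseqE)
  then have M: "\<bar>apply_bcontfun (y k) n\<bar> \<le> M" for k n
    using norm_bounded[of "y k" n] order_trans by (metis real_norm_def)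
  have "bounded (range a)"
    using abs_rough_Lim_le[OF I a r M] by (intro boundedI[of _ "M + r + 1"]) auto
  then obtain b s where s: "strict_mono (s :: nat \<Rightarrow> nat)" "(a \<circ> s) \<longlonglongrightarrow> b"
    using bounded_imp_convergent_subsequence by blast
  have "{n. apply_bcontfun x n \<notin> U} \<in> I" if U: "open U" "F b \<subseteq> U" for U
  proof -
    \<comment> \<open>Compactness gives \<open>F b\<close> a positive distance from the complement
      of \<open>U\<close>, hence a whole \<open>e\<close>-neighbourhood inside
      \<open>U\<close>.\<close>
    have "compact (F b)"
      using r[of b] cl[of b] by (meson bounded_closed_interval bounded_subset compact_eq_bounded_closed)
    then obtain e where e: "e > 0" "{t. infdist t (F b) \<le> e} \<subseteq> U"
      using compact_in_open_separated[OF ne _ U] by metis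
    \<comment> \<open>Half of \<open>e\<close> is spent on the distance of the terms of
      \<open>y (s k)\<close> from \<open>F b\<close>, the other half on the distance from
      \<open>y (s k)\<close> to \<open>x\<close>.\<close>
    define V where "V = {t. infdist t (F b) < e / 2}"
    have "open V" unfolding V_def by (intro open_Collect_less continuous_intros)
    moreover have "F b \<subseteq> V" using e(1) by (auto simp: V_def)
    ultimately have "\<forall>\<^sub>F k in sequentially. F ((a \<circ> s) k) \<subseteq> V"
      using eventually_subset_of_upper_vietoris[OF cont s(2)] by blast
    moreover have "\<forall>\<^sub>F k in sequentially. dist ((y \<circ> s) k) x < e / 2"
      using tendstoD[OF LIMSEQ_subseq_LIMSEQ[OF lim s(1)], of "e / 2"] e(1) by simp
    \<comment> \<open>One good \<open>k\<close> suffices: the exceptional set of \<open>x\<close>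
      for \<open>U\<close> is then contained in that of \<open>y (s k)\<close> for \<open>V\<close>,
      which is in the ideal.\<close>
    ultimately have "\<exists>k. F ((a \<circ> s) k) \<subseteq> V \<and> dist ((y \<circ> s) k) x < e / 2"
      by (intro eventually_happens'[OF sequentially_bot] eventually_conj)
    then obtain k where k: "F (a (s k)) \<subseteq> V" "dist (y (s k)) x < e / 2" by auto
    have "apply_bcontfun x n \<in> U" if "apply_bcontfun (y (s k)) n \<in> V" for n
    proof -
      have "dist (apply_bcontfun x n) (apply_bcontfun (y (s k)) n) < e / 2"
        using dist_bounded[of "y (s k)" n x] k(2) by (simp add: dist_commute)
      then have "infdist (apply_bcontfun x n) (F b) \<le> e"
        using that infdist_triangle[of "apply_bcontfun x n" "F b" "apply_bcontfun (y (s k)) n"]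
        by (auto simp: V_def)
      then show ?thesis using e(2) by blast
    qed
    then have "{n. apply_bcontfun x n \<notin> U} \<subseteq> {n. apply_bcontfun (y (s k)) n \<notin> V}" by blast
    moreover have "{n. apply_bcontfun (y (s k)) n \<notin> V} \<in> I"
      using a[of "s k"] k(1) \<open>open V\<close> unfolding rough_Lim_def by blast
    ultimately show ?thesis by (metis omega_idealD(1)[OF I])
  qed
  then have "b \<in> rough_Lim (apply_bcontfun x) I F" unfolding rough_Lim_def by blast
  then show "x \<in> cb_rough I F" unfolding cb_rough_def by blast
qed

theorem theorem2p17:
  fixes I :: "nat set set" and F :: "real \<Rightarrow> real set"
  assumes "omega_ideal I"
    and "rough_family F"
    and "uniformly_bounded_family F"
    and "\<And>\<eta>. closed (F \<eta>)"
    and "continuous_map euclidean upper_vietoris F"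
  shows "cb_rough I F = closure (cb_rough_star I F)"
proof
  have ne: "F \<eta> \<noteq> {}" for \<eta> using assms(2) unfolding rough_family_def by blast
  show "cb_rough I F \<subseteq> closure (cb_rough_star I F)"
    by (rule cb_rough_subset_closure[OF assms(1,4) ne])
  have "cb_rough_star I F \<subseteq> cb_rough I F"
    using rough_Lim_star_subset_rough_Lim[OF assms(1)]
    unfolding cb_rough_def cb_rough_star_def by blast
  then show "closure (cb_rough_star I F) \<subseteq> cb_rough I F"
    using closed_cb_rough[OF assms(1) ne assms(3-5)] by (rule closure_minimal)
qed

end
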